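(* Let $B_3$ be the braid group on three strands with generators $\sigma_1,\sigma_2$, let $F_2=\langle\sigma_1^2,\sigma_2^2\rangle\subset B_3$, and let $\preceq_C$ be the ordering of $F_2$ with positive cone $P=P_{DD}\cap F_2$, where $P_{DD}\subset B_3$ is the positive cone of the Dubrovina–Dubrovin ordering. Suppose that $S$ is a subgroup of $F_2$ that is convex in the ordering $\preceq_C$. If $S$ properly contains $\langle\sigma_2^{-2}\rangle$, then $S=F_2$.
   Context: $B_3=\langle\sigma_1,\sigma_2\mid \sigma_1\sigma_2\sigma_1=\sigma_2\sigma_1\sigma_2\rangle$. A word in $\sigma_1^{\pm1},\sigma_2^{\pm1}$ is $1$-positive if $\sigma_1$ occurs in it, and only with positive exponents; a word in $\sigma_2^{\pm1}$ only is $2$-positive if $\sigma_2$ occurs in it, and only with positive exponents. A braid is $i$-positive if it is represented by some $i$-positive word; $P_i\subset B_3$ denotes the set of $i$-positive braids (so $P_2=\{\sigma_2^k:k>0\}$), and $P_i^{-1}$ the set of inverses of its elements. The Dubrovina–Dubrovin positive cone is $P_{DD}=P_1\cup P_2^{-1}$; it is known to be the positive cone of an ordering of $B_3$. The subgroup $\langle\sigma_1^2,\sigma_2^2\rangle$ of $B_3$ is known to be free on the two generators $\sigma_1^2,\sigma_2^2$. An ordering on a group is a total order relation invariant under left multiplication; its positive cone is the set of elements $\succ1$, which determines it ($a\prec b$ iff $a^{-1}b$ is in the positive cone). A subset $S$ of an ordered group is convex if whenever $f_1\prec f\prec f_2$ with $f_1,f_2\in S$, then $f\in S$. *)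

theory Defs
  imports "HOL-Algebra.Algebra"
begin

section \<open>The braid group on three strands, by its Artin presentation\<close>

datatype artin_gen = Sigma1 | Sigma2

text \<open>The letter \<open>(g, True)\<close> stands for the generator \<open>g\<close>, and \<open>(g, False)\<close> for its formal inverse.\<close>

type_synonym braid_word = "(artin_gen \<times> bool) list"

inductive braid_equiv :: "braid_word \<Rightarrow> braid_word \<Rightarrow> bool" where
  refl: "braid_equiv w w"
| sym: "braid_equiv u v \<Longrightarrow> braid_equiv v u"
| trans: "braid_equiv u v \<Longrightarrow> braid_equiv v w \<Longrightarrow> braid_equiv u w"
| cancel: "braid_equiv (u @ [(g, e), (g, \<not> e)] @ v) (u @ v)"
| braid: "braid_equiv (u @ [(Sigma1, True), (Sigma2, True), (Sigma1, True)] @ v)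
                      (u @ [(Sigma2, True), (Sigma1, True), (Sigma2, True)] @ v)"

lemma braid_equiv_context:
  "braid_equiv u v \<Longrightarrow> braid_equiv (a @ u @ b) (a @ v @ b)"
proof (induction rule: braid_equiv.induct)
  case (cancel u g e v)
  show ?case using braid_equiv.cancel[of "a @ u" g e "v @ b"] by simp
next
  case (braid u v)
  show ?case using braid_equiv.braid[of "a @ u" "v @ b"] by simp
qed (blast intro: braid_equiv.intros)+

lemma braid_equiv_append:
  assumes "braid_equiv u u'" "braid_equiv v v'"
  shows "braid_equiv (u @ v) (u' @ v')"
  using braid_equiv_context[OF assms(1), of "[]" v] braid_equiv_context[OF assms(2), of u' "[]"]
  by (auto intro: braid_equiv.trans)

quotient_type braid3 = braid_word / braid_equiv
  morphisms rep_braid braid_of_word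
  by (intro equivpI reflpI sympI transpI) (blast intro: braid_equiv.intros)+

lemma braid_word_exists: "\<exists>w. x = braid_of_word w"
  by (induction x rule: braid3.abs_induct) blast

lift_definition braid_mult :: "braid3 \<Rightarrow> braid3 \<Rightarrow> braid3" is "(@)"
  by (rule braid_equiv_append)

definition B3 :: "braid3 monoid" where
  "B3 = \<lparr>carrier = UNIV, monoid.mult = braid_mult, one = braid_of_word []\<rparr>"

definition \<sigma>\<^sub>1 :: braid3 where "\<sigma>\<^sub>1 = braid_of_word [(Sigma1, True)]"
definition \<sigma>\<^sub>2 :: braid3 where "\<sigma>\<^sub>2 = braid_of_word [(Sigma2, True)]"

lemma carrier_B3 [simp]: "carrier B3 = UNIV"
  by (simp add: B3_def)

lemma one_B3: "\<one>\<^bsub>B3\<^esub> = braid_of_word []"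
  by (simp add: B3_def)

lemma mult_B3: "braid_of_word u \<otimes>\<^bsub>B3\<^esub> braid_of_word v = braid_of_word (u @ v)"
  by (simp add: B3_def braid_mult.abs_eq)

definition inv_word :: "braid_word \<Rightarrow> braid_word" where
  "inv_word w = rev (map (\<lambda>(g, e). (g, \<not> e)) w)"

lemma inv_word_left: "braid_equiv (inv_word w @ w) []"
proof (induction w)
  case Nil
  show ?case by (simp add: inv_word_def braid_equiv.refl)
next
  case (Cons l w)
  obtain g e where l: "l = (g, e)" by (cases l)
  have "braid_equiv (inv_word (l # w) @ l # w) (inv_word w @ w)"
    using braid_equiv.cancel[of "inv_word w" g "\<not> e" w] by (simp add: inv_word_def l)
  then show ?case using Cons.IH by (blast intro: braid_equiv.trans)
qed

lemma group_B3: "group B3"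
proof (rule groupI)
  fix x y z :: braid3
  obtain u v w where [simp]: "x = braid_of_word u" "y = braid_of_word v" "z = braid_of_word w"
    using braid_word_exists by metis
  show "x \<otimes>\<^bsub>B3\<^esub> y \<otimes>\<^bsub>B3\<^esub> z = x \<otimes>\<^bsub>B3\<^esub> (y \<otimes>\<^bsub>B3\<^esub> z)"
    by (simp add: mult_B3)
next
  fix x :: braid3
  obtain w where [simp]: "x = braid_of_word w"
    using braid_word_exists by metis
  show "\<one>\<^bsub>B3\<^esub> \<otimes>\<^bsub>B3\<^esub> x = x"
    by (simp add: one_B3 mult_B3)
  have "braid_of_word (inv_word w) \<otimes>\<^bsub>B3\<^esub> x = \<one>\<^bsub>B3\<^esub>"
    using inv_word_left by (simp add: one_B3 mult_B3 braid3.abs_eq_iff)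
  then show "\<exists>y\<in>carrier B3. y \<otimes>\<^bsub>B3\<^esub> x = \<one>\<^bsub>B3\<^esub>"
    by auto
qed simp_all

lemma inv_B3: "inv\<^bsub>B3\<^esub> (braid_of_word w) = braid_of_word (inv_word w)"
  by (rule group.inv_equality[OF group_B3])
    (use inv_word_left in \<open>simp_all add: one_B3 mult_B3 braid3.abs_eq_iff\<close>)

lemma braid_relation: "\<sigma>\<^sub>1 \<otimes>\<^bsub>B3\<^esub> \<sigma>\<^sub>2 \<otimes>\<^bsub>B3\<^esub> \<sigma>\<^sub>1 = \<sigma>\<^sub>2 \<otimes>\<^bsub>B3\<^esub> \<sigma>\<^sub>1 \<otimes>\<^bsub>B3\<^esub> \<sigma>\<^sub>2"
  using braid_equiv.braid[of "[]" "[]"]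
  by (simp add: \<sigma>\<^sub>1_def \<sigma>\<^sub>2_def mult_B3 braid3.abs_eq_iff)

section \<open>The Dubrovina--Dubrovin positive cone\<close>

definition word_1_positive :: "braid_word \<Rightarrow> bool" where
  "word_1_positive w \<longleftrightarrow> (Sigma1, True) \<in> set w \<and> (Sigma1, False) \<notin> set w"

definition word_2_positive :: "braid_word \<Rightarrow> bool" where
  "word_2_positive w \<longleftrightarrow>
     (\<forall>e. (Sigma1, e) \<notin> set w) \<and> (Sigma2, True) \<in> set w \<and> (Sigma2, False) \<notin> set w"

definition P1 :: "braid3 set" where
  "P1 = {braid_of_word w | w. word_1_positive w}"

definition P2 :: "braid3 set" where
  "P2 = {braid_of_word w | w. word_2_positive w}"

definition P_DD :: "braid3 set" where
  "P_DD = P1 \<union> m_inv B3 ` P2"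

section \<open>Orderings given by positive cones\<close>

definition cone_less :: "('a, 'b) monoid_scheme \<Rightarrow> 'a set \<Rightarrow> 'a \<Rightarrow> 'a \<Rightarrow> bool" where
  "cone_less G P a b \<longleftrightarrow> inv\<^bsub>G\<^esub> a \<otimes>\<^bsub>G\<^esub> b \<in> P"

definition order_convex :: "'a set \<Rightarrow> ('a \<Rightarrow> 'a \<Rightarrow> bool) \<Rightarrow> 'a set \<Rightarrow> bool" where
  "order_convex A lt S \<longleftrightarrow>
     S \<subseteq> A \<and> (\<forall>f\<^sub>1\<in>S. \<forall>f\<^sub>2\<in>S. \<forall>f\<in>A. lt f\<^sub>1 f \<and> lt f f\<^sub>2 \<longrightarrow> f \<in> S)"

section \<open>The free subgroup and its ordering\<close>

definition F2 :: "braid3 monoid" where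
  "F2 = subgroup_generated B3 {\<sigma>\<^sub>1 [^]\<^bsub>B3\<^esub> (2::nat), \<sigma>\<^sub>2 [^]\<^bsub>B3\<^esub> (2::nat)}"

definition P_C :: "braid3 set" where
  "P_C = P_DD \<inter> carrier F2"

definition less_C :: "braid3 \<Rightarrow> braid3 \<Rightarrow> bool" where
  "less_C = cone_less F2 P_C"

end

theory Submission
  imports Defs
begin

text \<open>
  Every element of a convex subgroup \<open>S\<close> larger than \<open>\<langle>\<sigma>\<^sub>2\<^sup>-\<^sup>2\<rangle>\<close> other than the powers of \<open>\<sigma>\<^sub>2\<close>
  is \<open>1\<close>-positive or inverse to a \<open>1\<close>-positive braid (\<open>sigma1_trichotomy\<close>), and the only powers
  of \<open>\<sigma>\<^sub>2\<close> in \<open>F\<^sub>2\<close> are the even ones (\<open>sigma2_pow_F2_even\<close>). So \<open>S\<close> contains a \<open>1\<close>-positive braid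
  \<open>\<sigma>\<^sub>2\<^sup>j \<sigma>\<^sub>1 y\<close>, where \<open>y\<close> has a word without \<open>\<sigma>\<^sub>1\<^sup>-\<^sup>1\<close>. Multiplying it on the left by a large even power
  of \<open>\<sigma>\<^sub>2\<close>, which also lies in \<open>S\<close>, makes the exponent \<open>j\<close> positive, and then the conjugation rule
  \<open>\<sigma>\<^sub>1\<^sup>-\<^sup>1 \<sigma>\<^sub>2\<^sup>n \<sigma>\<^sub>1 = \<sigma>\<^sub>2 \<sigma>\<^sub>1\<^sup>n \<sigma>\<^sub>2\<^sup>-\<^sup>1\<close> lets it absorb \<open>\<sigma>\<^sub>1\<^sup>-\<^sup>2\<close> and stay \<open>1\<close>-positive
  (\<open>sigma1_square_below\<close>). Thus \<open>\<sigma>\<^sub>1\<^sup>2\<close> lies between \<open>1\<close> and an element of \<open>S\<close>; convexity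
  puts it in \<open>S\<close>, together with \<open>\<sigma>\<^sub>2\<^sup>2\<close>, and these two generate \<open>F\<^sub>2\<close>.

  For three strands the trichotomy has a short proof, without handle reduction. Let \<open>\<Delta>\<close> be the half
  twist; conjugation by it exchanges \<open>\<sigma>\<^sub>1\<close> and \<open>\<sigma>\<^sub>2\<close>. In \<open>\<sigma>\<^sub>1 \<sigma>\<^sub>2 = \<Delta> \<sigma>\<^sub>1\<^sup>-\<^sup>1\<close> and its analogues two
  different generators with exponents of equal sign become one letter of opposite sign at the cost
  of a power of \<open>\<Delta>\<close>, so each braid is \<open>\<Delta>\<^sup>n w\<close> where \<open>w\<close> is a word either in
  \<open>\<sigma>\<^sub>1, \<sigma>\<^sub>2\<^sup>-\<^sup>1\<close> or in \<open>\<sigma>\<^sub>1\<^sup>-\<^sup>1, \<sigma>\<^sub>2\<close> (\<open>\<Delta>_normal_form\<close>). Moving one \<open>\<Delta>\<close> across \<open>w\<close> changes between these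
  two kinds of words; hence for \<open>n > 0\<close> the braid is \<open>1\<close>-positive whichever kind \<open>w\<close> is,
  and inversion settles \<open>n < 0\<close>.
\<close>

interpretation B3: group B3
  by (rule group_B3)

lemma braid_of_word_append: "braid_of_word (u @ v) = braid_of_word u \<otimes>\<^bsub>B3\<^esub> braid_of_word v"
  by (simp add: mult_B3)

lemma braid_of_word_Cons: "braid_of_word (l # v) = braid_of_word [l] \<otimes>\<^bsub>B3\<^esub> braid_of_word v"
  by (simp add: mult_B3)

lemma braid_of_letter:
  "braid_of_word [(Sigma1, True)] = \<sigma>\<^sub>1" "braid_of_word [(Sigma1, False)] = inv\<^bsub>B3\<^esub> \<sigma>\<^sub>1"
  "braid_of_word [(Sigma2, True)] = \<sigma>\<^sub>2" "braid_of_word [(Sigma2, False)] = inv\<^bsub>B3\<^esub> \<sigma>\<^sub>2"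
  by (simp_all add: \<sigma>\<^sub>1_def \<sigma>\<^sub>2_def inv_B3 inv_word_def)

lemma B3_pow_Suc2: "x [^]\<^bsub>B3\<^esub> Suc n = x \<otimes>\<^bsub>B3\<^esub> x [^]\<^bsub>B3\<^esub> n"
  by (rule B3.nat_pow_Suc2) simp

section \<open>Braids represented without inverses of the first generator\<close>

text \<open>
  Powers of \<open>\<sigma>\<^sub>2\<close> of either sign are harmless as factors of a \<open>1\<close>-positive braid. The monoid \<open>N1\<close>
  collects all harmless factors, and \<open>P1\<close> absorbs it on both sides.
\<close>

definition N1 :: "braid3 set" where
  "N1 = {braid_of_word w | w. (Sigma1, False) \<notin> set w}"

lemma N1_mult: "x \<in> N1 \<Longrightarrow> y \<in> N1 \<Longrightarrow> x \<otimes>\<^bsub>B3\<^esub> y \<in> N1"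
  unfolding N1_def by (clarsimp simp: mult_B3) (metis UnE set_append)

lemma N1_P1_mult: "x \<in> N1 \<Longrightarrow> y \<in> P1 \<Longrightarrow> x \<otimes>\<^bsub>B3\<^esub> y \<in> P1"
  unfolding N1_def P1_def word_1_positive_def
  by (clarsimp simp: mult_B3) (metis UnCI UnE set_append)

lemma P1_N1_mult: "x \<in> P1 \<Longrightarrow> y \<in> N1 \<Longrightarrow> x \<otimes>\<^bsub>B3\<^esub> y \<in> P1"
  unfolding N1_def P1_def word_1_positive_def
  by (clarsimp simp: mult_B3) (metis UnCI UnE set_append)

lemma P1_subset_N1: "P1 \<subseteq> N1"
  by (auto simp: P1_def N1_def word_1_positive_def)

lemma one_in_N1: "\<one>\<^bsub>B3\<^esub> \<in> N1"
  by (auto simp: N1_def one_B3 intro!: exI[of _ "[]"])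

lemma N1_pow: "x \<in> N1 \<Longrightarrow> x [^]\<^bsub>B3\<^esub> (n::nat) \<in> N1"
  by (induction n) (auto simp: one_in_N1 N1_mult)

lemma generators_in_cone:
  "\<sigma>\<^sub>1 \<in> P1" "\<sigma>\<^sub>2 \<in> N1" "inv\<^bsub>B3\<^esub> \<sigma>\<^sub>2 \<in> N1"
proof -
  show "\<sigma>\<^sub>1 \<in> P1"
    unfolding P1_def word_1_positive_def
    by (intro CollectI exI[of _ "[(Sigma1, True)]"]) (simp add: braid_of_letter)
  show "\<sigma>\<^sub>2 \<in> N1"
    unfolding N1_def by (intro CollectI exI[of _ "[(Sigma2, True)]"]) (simp add: braid_of_letter)
  show "inv\<^bsub>B3\<^esub> \<sigma>\<^sub>2 \<in> N1"
    unfolding N1_def by (intro CollectI exI[of _ "[(Sigma2, False)]"]) (simp add: braid_of_letter)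
qed

lemma word_in_sigma2:
  assumes "\<forall>e. (Sigma1, e) \<notin> set w"
  shows "\<exists>j::int. braid_of_word w = \<sigma>\<^sub>2 [^]\<^bsub>B3\<^esub> j"
  using assms
proof (induction w)
  case Nil
  show ?case by (intro exI[of _ 0]) (simp add: one_B3)
next
  case (Cons l w)
  then obtain j :: int where j: "braid_of_word w = \<sigma>\<^sub>2 [^]\<^bsub>B3\<^esub> j" by auto
  obtain e where l: "l = (Sigma2, e)"
    using Cons.prems by (cases l; cases "fst l") auto
  have "braid_of_word [l] = \<sigma>\<^sub>2 [^]\<^bsub>B3\<^esub> (if e then 1 else -1 :: int)"
    by (simp add: l braid_of_letter B3.int_pow_neg)
  then show ?case
    unfolding braid_of_word_Cons[of l w] j by (metis B3.int_pow_mult UNIV_I carrier_B3)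
qed

lemma N1_cases:
  assumes "x \<in> N1"
  shows "x \<in> P1 \<or> (\<exists>j::int. x = \<sigma>\<^sub>2 [^]\<^bsub>B3\<^esub> j)"
proof -
  obtain w where w: "x = braid_of_word w" "(Sigma1, False) \<notin> set w"
    using assms by (auto simp: N1_def)
  show ?thesis
  proof (cases "(Sigma1, True) \<in> set w")
    case True
    then show ?thesis using w by (auto simp: P1_def word_1_positive_def)
  next
    case False
    then have "\<forall>e. (Sigma1, e) \<notin> set w" using w(2) by (metis (full_types))
    then show ?thesis using w(1) word_in_sigma2 by auto
  qed
qed

lemma P1_first_sigma1:
  assumes "x \<in> P1"
  obtains j :: int and y where "x = \<sigma>\<^sub>2 [^]\<^bsub>B3\<^esub> j \<otimes>\<^bsub>B3\<^esub> (\<sigma>\<^sub>1 \<otimes>\<^bsub>B3\<^esub> y)" "y \<in> N1"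
proof -
  obtain w where w: "x = braid_of_word w" "(Sigma1, True) \<in> set w" "(Sigma1, False) \<notin> set w"
    using assms by (auto simp: P1_def word_1_positive_def)
  obtain u v where uv: "w = u @ (Sigma1, True) # v" "(Sigma1, True) \<notin> set u"
    using split_list_first[OF w(2)] by auto
  have "\<forall>e. (Sigma1, e) \<notin> set u" using uv w(3)
    by (metis (full_types) UnCI set_append)
  then obtain j :: int where "braid_of_word u = \<sigma>\<^sub>2 [^]\<^bsub>B3\<^esub> j" using word_in_sigma2 by blast
  then have "x = \<sigma>\<^sub>2 [^]\<^bsub>B3\<^esub> j \<otimes>\<^bsub>B3\<^esub> (\<sigma>\<^sub>1 \<otimes>\<^bsub>B3\<^esub> braid_of_word v)"
    by (simp add: w(1) uv(1) braid_of_word_append braid_of_word_Cons[of _ v] braid_of_letter)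
  moreover have "braid_of_word v \<in> N1" using w(3) uv(1) by (auto simp: N1_def)
  ultimately show ?thesis by (rule that)
qed

section \<open>The half twist and trichotomy\<close>

definition \<Delta> :: braid3 where
  "\<Delta> = \<sigma>\<^sub>1 \<otimes>\<^bsub>B3\<^esub> \<sigma>\<^sub>2 \<otimes>\<^bsub>B3\<^esub> \<sigma>\<^sub>1"

lemma \<Delta>_alt: "\<Delta> = \<sigma>\<^sub>2 \<otimes>\<^bsub>B3\<^esub> \<sigma>\<^sub>1 \<otimes>\<^bsub>B3\<^esub> \<sigma>\<^sub>2"
  by (simp add: \<Delta>_def braid_relation)

lemma \<Delta>_in_P1: "\<Delta> \<in> P1"
  unfolding \<Delta>_def using generators_in_cone N1_P1_mult P1_N1_mult P1_subset_N1 by blast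

fun swap_letter :: "artin_gen \<times> bool \<Rightarrow> artin_gen \<times> bool" where
  "swap_letter (Sigma1, e) = (Sigma2, e)"
| "swap_letter (Sigma2, e) = (Sigma1, e)"

text \<open>
  Both conclusions are needed because letters occur with either sign and are moved across
  negative powers of \<open>\<Delta>\<close> as well.
\<close>

lemma inv_intertwine:
  assumes "x \<otimes>\<^bsub>B3\<^esub> d = d \<otimes>\<^bsub>B3\<^esub> y"
  shows "inv\<^bsub>B3\<^esub> x \<otimes>\<^bsub>B3\<^esub> d = d \<otimes>\<^bsub>B3\<^esub> inv\<^bsub>B3\<^esub> y"
    and "y \<otimes>\<^bsub>B3\<^esub> inv\<^bsub>B3\<^esub> d = inv\<^bsub>B3\<^esub> d \<otimes>\<^bsub>B3\<^esub> x"
proof -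
  have x: "x = d \<otimes>\<^bsub>B3\<^esub> y \<otimes>\<^bsub>B3\<^esub> inv\<^bsub>B3\<^esub> d"
    using assms by (metis B3.inv_solve_right UNIV_I carrier_B3)
  show "inv\<^bsub>B3\<^esub> x \<otimes>\<^bsub>B3\<^esub> d = d \<otimes>\<^bsub>B3\<^esub> inv\<^bsub>B3\<^esub> y"
    by (simp add: x B3.inv_mult_group B3.m_assoc)
  show "y \<otimes>\<^bsub>B3\<^esub> inv\<^bsub>B3\<^esub> d = inv\<^bsub>B3\<^esub> d \<otimes>\<^bsub>B3\<^esub> x"
    by (simp add: x B3.m_assoc[symmetric])
qed

lemma letter_\<Delta>: "braid_of_word [l] \<otimes>\<^bsub>B3\<^esub> \<Delta> = \<Delta> \<otimes>\<^bsub>B3\<^esub> braid_of_word [swap_letter l]"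
proof -
  have 1: "\<sigma>\<^sub>1 \<otimes>\<^bsub>B3\<^esub> \<Delta> = \<Delta> \<otimes>\<^bsub>B3\<^esub> \<sigma>\<^sub>2"
    by (subst \<Delta>_alt) (simp add: \<Delta>_def B3.m_assoc)
  have 2: "\<sigma>\<^sub>2 \<otimes>\<^bsub>B3\<^esub> \<Delta> = \<Delta> \<otimes>\<^bsub>B3\<^esub> \<sigma>\<^sub>1"
    by (subst (2) \<Delta>_alt) (simp add: \<Delta>_def B3.m_assoc)
  show ?thesis
    by (cases l rule: swap_letter.cases; rename_tac e; case_tac e)
      (simp_all add: braid_of_letter 1 2 inv_intertwine(1)[OF 1] inv_intertwine(1)[OF 2])
qed

lemma word_\<Delta>:
  "braid_of_word w \<otimes>\<^bsub>B3\<^esub> \<Delta> = \<Delta> \<otimes>\<^bsub>B3\<^esub> braid_of_word (map swap_letter w)"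
proof (induction w)
  case Nil
  show ?case by (simp flip: one_B3)
next
  case (Cons l w)
  then show ?case
    by (simp add: braid_of_word_Cons[of l w] braid_of_word_Cons[of _ "map _ _"] B3.m_assoc)
      (simp add: letter_\<Delta> flip: B3.m_assoc)
qed

lemma swap_swap [simp]: "swap_letter (swap_letter l) = l"
  by (cases l rule: swap_letter.cases) auto

lemma letter_\<Delta>_pow:
  "\<exists>m. braid_of_word [l] \<otimes>\<^bsub>B3\<^esub> \<Delta> [^]\<^bsub>B3\<^esub> (n::int) = \<Delta> [^]\<^bsub>B3\<^esub> n \<otimes>\<^bsub>B3\<^esub> braid_of_word [m]"
proof (induction n rule: int_induct[of _ 0])
  case base
  show ?case by (intro exI[of _ l]) simp
next
  case (step1 n)
  then obtain m where "braid_of_word [l] \<otimes>\<^bsub>B3\<^esub> \<Delta> [^]\<^bsub>B3\<^esub> n = \<Delta> [^]\<^bsub>B3\<^esub> n \<otimes>\<^bsub>B3\<^esub> braid_of_word [m]" by auto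
  then have "braid_of_word [l] \<otimes>\<^bsub>B3\<^esub> \<Delta> [^]\<^bsub>B3\<^esub> (n + 1)
      = \<Delta> [^]\<^bsub>B3\<^esub> (n + 1) \<otimes>\<^bsub>B3\<^esub> braid_of_word [swap_letter m]"
    by (simp add: B3.int_pow_mult flip: B3.m_assoc) (simp add: B3.m_assoc letter_\<Delta>)
  then show ?case by (rule exI)
next
  case (step2 n)
  then obtain m where "braid_of_word [l] \<otimes>\<^bsub>B3\<^esub> \<Delta> [^]\<^bsub>B3\<^esub> n = \<Delta> [^]\<^bsub>B3\<^esub> n \<otimes>\<^bsub>B3\<^esub> braid_of_word [m]" by auto
  moreover have "braid_of_word [m] \<otimes>\<^bsub>B3\<^esub> inv\<^bsub>B3\<^esub> \<Delta> = inv\<^bsub>B3\<^esub> \<Delta> \<otimes>\<^bsub>B3\<^esub> braid_of_word [swap_letter m]"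
    using inv_intertwine(2)[OF letter_\<Delta>[of "swap_letter m"]] by simp
  ultimately have "braid_of_word [l] \<otimes>\<^bsub>B3\<^esub> \<Delta> [^]\<^bsub>B3\<^esub> (n + - 1)
      = \<Delta> [^]\<^bsub>B3\<^esub> (n + - 1) \<otimes>\<^bsub>B3\<^esub> braid_of_word [swap_letter m]"
    by (subst (1 2) B3.int_pow_mult) (simp_all add: B3.int_pow_neg B3.m_assoc flip: B3.m_assoc[of _ "\<Delta> [^]\<^bsub>B3\<^esub> n"])
  then show ?case by (intro exI[of _ "swap_letter m"]) simp
qed

text \<open>
  The rewriting step behind the normal form. The letter that remains is the inverse of the first
  one, so it is of the same kind (in the sense of \<open>opposite_letters\<close> below) as the second one.
\<close>

lemma distinct_letters_\<Delta>:
  assumes "g \<noteq> h"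
  shows "braid_of_word [(g, e), (h, e)]
    = \<Delta> [^]\<^bsub>B3\<^esub> (if e then 1 else - 1 :: int) \<otimes>\<^bsub>B3\<^esub> braid_of_word [(g, \<not> e)]"
proof (cases g)
  case Sigma1
  then have "h = Sigma2" using assms by (cases h) auto
  then show ?thesis
    by (cases e) (simp_all add: Sigma1 braid_of_word_Cons[of _ "[_]"] braid_of_letter \<Delta>_def
        B3.int_pow_neg B3.inv_mult_group B3.m_assoc)
next
  case Sigma2
  then have "h = Sigma1" using assms by (cases h) auto
  then show ?thesis
    by (cases e) (simp_all add: Sigma2 braid_of_word_Cons[of _ "[_]"] braid_of_letter \<Delta>_alt
        B3.int_pow_neg B3.inv_mult_group B3.m_assoc)
qed

text \<open>
  Modulo the centre, \<open>\<sigma>\<^sub>1\<close> and \<open>\<sigma>\<^sub>2\<^sup>-\<^sup>1\<close> correspond to the elementary matrices with nonnegative entries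
  in \<open>PSL\<^sub>2(\<int>)\<close>, and \<open>\<Delta>\<close> to the element of order two.
\<close>

definition opposite_letters :: "bool \<Rightarrow> (artin_gen \<times> bool) set" where
  "opposite_letters e = {(Sigma1, e), (Sigma2, \<not> e)}"

lemma swap_opposite: "set w \<subseteq> opposite_letters e \<Longrightarrow> set (map swap_letter w) \<subseteq> opposite_letters (\<not> e)"
  by (fastforce simp: opposite_letters_def)

lemma inv_word_opposite: "set w \<subseteq> opposite_letters e \<Longrightarrow> set (inv_word w) \<subseteq> opposite_letters (\<not> e)"
  by (fastforce simp: opposite_letters_def inv_word_def)

text \<open>
  A new letter of the wrong kind either cancels against the first letter of \<open>w\<close>, or has the same
  sign but a different generator, where \<open>distinct_letters_\<Delta>\<close> applies.
\<close>

lemma letter_opposite_word: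
  assumes "set w \<subseteq> opposite_letters e"
  shows "\<exists>n d v. braid_of_word (l # w) = \<Delta> [^]\<^bsub>B3\<^esub> (n::int) \<otimes>\<^bsub>B3\<^esub> braid_of_word v
    \<and> set v \<subseteq> opposite_letters d"
proof -
  obtain g s where l: "l = (g, s)" by (cases l)
  consider "l \<in> opposite_letters e" | "w = []" | h v where "w = (h, \<not> s) # v" "h = g"
    | h v where "w = (h, s) # v" "h \<noteq> g" "(g, \<not> s) \<in> opposite_letters e"
    using assms l by (cases g; cases w) (auto simp: opposite_letters_def)
  then show ?thesis
  proof cases
    case 1
    then show ?thesis using assms
      by (intro exI[of _ 0] exI[of _ e] exI[of _ "l # w"]) auto
  next
    case 2
    have "l \<in> opposite_letters (if g = Sigma1 then s else \<not> s)"
      by (cases g) (auto simp: opposite_letters_def l)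
    then show ?thesis using 2
      by (intro exI[of _ 0] exI[of _ "if g = Sigma1 then s else \<not> s"] exI[of _ "[l]"]) auto
  next
    case 3
    then have "braid_of_word (l # w) = braid_of_word v"
      using braid_equiv.cancel[of "[]" g s v] by (simp add: l braid3.abs_eq_iff)
    then show ?thesis using 3 assms
      by (intro exI[of _ 0] exI[of _ e] exI[of _ v]) auto
  next
    case 4
    have "braid_of_word (l # w) = braid_of_word [(g, s), (h, s)] \<otimes>\<^bsub>B3\<^esub> braid_of_word v"
      by (simp add: l 4 mult_B3)
    also have "\<dots> = \<Delta> [^]\<^bsub>B3\<^esub> (if s then 1 else - 1 :: int) \<otimes>\<^bsub>B3\<^esub> braid_of_word ((g, \<not> s) # v)"
      using distinct_letters_\<Delta>[of g h s] 4(2) by (simp add: B3.m_assoc mult_B3)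
    finally show ?thesis using 4 assms
      by (intro exI[of _ "if s then 1 else - 1 :: int"] exI[of _ e] exI[of _ "(g, \<not> s) # v"]) auto
  qed
qed

lemma \<Delta>_normal_form:
  "\<exists>n e v. braid_of_word w = \<Delta> [^]\<^bsub>B3\<^esub> (n::int) \<otimes>\<^bsub>B3\<^esub> braid_of_word v \<and> set v \<subseteq> opposite_letters e"
proof (induction w)
  case Nil
  show ?case by (intro exI[of _ 0] exI[of _ True] exI[of _ "[]"]) auto
next
  case (Cons l w)
  then obtain n :: int and e v where v: "braid_of_word w = \<Delta> [^]\<^bsub>B3\<^esub> n \<otimes>\<^bsub>B3\<^esub> braid_of_word v"
    "set v \<subseteq> opposite_letters e" by blast
  obtain m where m: "braid_of_word [l] \<otimes>\<^bsub>B3\<^esub> \<Delta> [^]\<^bsub>B3\<^esub> n = \<Delta> [^]\<^bsub>B3\<^esub> n \<otimes>\<^bsub>B3\<^esub> braid_of_word [m]"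
    using letter_\<Delta>_pow by blast
  obtain k :: int and d u where u: "braid_of_word (m # v) = \<Delta> [^]\<^bsub>B3\<^esub> k \<otimes>\<^bsub>B3\<^esub> braid_of_word u"
    "set u \<subseteq> opposite_letters d"
    using letter_opposite_word[OF v(2)] by blast
  have "braid_of_word (l # w) = \<Delta> [^]\<^bsub>B3\<^esub> n \<otimes>\<^bsub>B3\<^esub> braid_of_word (m # v)"
    unfolding braid_of_word_Cons[of l w] braid_of_word_Cons[of m v] v(1)
    using m by (simp flip: B3.m_assoc)
  also have "\<dots> = \<Delta> [^]\<^bsub>B3\<^esub> (n + k) \<otimes>\<^bsub>B3\<^esub> braid_of_word u"
    by (simp add: u(1) B3.int_pow_mult B3.m_assoc)
  finally show ?case using u(2) by blast
qed

lemma opposite_word_N1: "set v \<subseteq> opposite_letters True \<Longrightarrow> braid_of_word v \<in> N1"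
  by (auto simp: opposite_letters_def N1_def)

text \<open>
  If \<open>v\<close> is a word in \<open>\<sigma>\<^sub>1\<^sup>-\<^sup>1, \<sigma>\<^sub>2\<close>, then \<open>\<Delta> v = v' \<Delta>\<close> with \<open>v'\<close> in \<open>\<sigma>\<^sub>2\<^sup>-\<^sup>1, \<sigma>\<^sub>1\<close>: a single \<open>\<Delta>\<close> removes
  all negative occurrences of \<open>\<sigma>\<^sub>1\<close>.
\<close>

lemma \<Delta>_opposite_word_P1:
  assumes "set v \<subseteq> opposite_letters e"
  shows "\<Delta> \<otimes>\<^bsub>B3\<^esub> braid_of_word v \<in> P1"
proof (cases e)
  case True
  then show ?thesis using assms by (intro P1_N1_mult \<Delta>_in_P1 opposite_word_N1) simp
next
  case False
  let ?u = "map swap_letter v"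
  have "set ?u \<subseteq> opposite_letters True" using swap_opposite[OF assms] False by simp
  then have "braid_of_word ?u \<otimes>\<^bsub>B3\<^esub> \<Delta> \<in> P1"
    by (intro N1_P1_mult \<Delta>_in_P1 opposite_word_N1)
  moreover have "map swap_letter ?u = v" by (simp add: comp_def)
  ultimately show ?thesis using word_\<Delta>[of ?u] by metis
qed

text \<open>
  For \<open>x = \<Delta>\<^sup>n v\<close> with \<open>n < 0\<close>, the inverse \<open>v\<^sup>-\<^sup>1 \<Delta>\<^sup>-\<^sup>n\<close> again has a positive power of \<open>\<Delta>\<close>, next to a
  word of one kind, so the previous lemma covers it too.
\<close>

theorem sigma1_trichotomy:
  "x \<in> P1 \<or> inv\<^bsub>B3\<^esub> x \<in> P1 \<or> (\<exists>j::int. x = \<sigma>\<^sub>2 [^]\<^bsub>B3\<^esub> j)"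
proof -
  obtain n :: int and e v where x: "x = \<Delta> [^]\<^bsub>B3\<^esub> n \<otimes>\<^bsub>B3\<^esub> braid_of_word v"
    and v: "set v \<subseteq> opposite_letters e"
    using braid_word_exists \<Delta>_normal_form by metis
  have \<Delta>N: "\<Delta> [^]\<^bsub>B3\<^esub> (k::nat) \<in> N1" for k
    using \<Delta>_in_P1 P1_subset_N1 N1_pow by blast
  consider "n = 0" | k where "n = int (Suc k)" | k where "n = - int (Suc k)"
    by (cases n rule: int_cases3) (metis not0_implies_Suc less_irrefl)+
  then show ?thesis
  proof cases
    case 1
    show ?thesis
    proof (cases e)
      case True
      then show ?thesis using N1_cases[OF opposite_word_N1] x v 1 by auto
    next
      case False
      have "inv\<^bsub>B3\<^esub> x \<in> N1"
        using opposite_word_N1 inv_word_opposite[OF v] False x 1 by (simp add: inv_B3)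
      then show ?thesis using N1_cases by (metis B3.int_pow_neg B3.inv_inv UNIV_I carrier_B3)
    qed
  next
    case 2
    have "x = \<Delta> [^]\<^bsub>B3\<^esub> k \<otimes>\<^bsub>B3\<^esub> (\<Delta> \<otimes>\<^bsub>B3\<^esub> braid_of_word v)"
      by (simp only: x 2 int_pow_int) (simp add: B3.m_assoc)
    then show ?thesis using N1_P1_mult[OF \<Delta>N \<Delta>_opposite_word_P1[OF v]] by simp
  next
    case 3
    let ?u = "map swap_letter (inv_word v)"
    have "inv\<^bsub>B3\<^esub> x = braid_of_word (inv_word v) \<otimes>\<^bsub>B3\<^esub> \<Delta> [^]\<^bsub>B3\<^esub> Suc k"
      by (simp only: x 3) (simp add: B3.inv_mult_group inv_B3 B3.int_pow_neg int_pow_int del: of_nat_Suc B3.nat_pow_Suc)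
    also have "\<dots> = \<Delta> \<otimes>\<^bsub>B3\<^esub> braid_of_word ?u \<otimes>\<^bsub>B3\<^esub> \<Delta> [^]\<^bsub>B3\<^esub> k"
      unfolding B3_pow_Suc2 word_\<Delta>[symmetric] by (simp add: B3.m_assoc)
    finally show ?thesis
      using P1_N1_mult[OF \<Delta>_opposite_word_P1[OF swap_opposite[OF inv_word_opposite[OF v]]] \<Delta>N]
      by simp
  qed
qed

section \<open>Parity of word length\<close>

text \<open>
  The braid relation preserves length and a cancellation changes it by two. Since the generators
  of \<open>F\<^sub>2\<close> are squares, no odd power of \<open>\<sigma>\<^sub>2\<close> belongs to \<open>F\<^sub>2\<close>.
\<close>

lemma braid_equiv_length: "braid_equiv u v \<Longrightarrow> even (length u) \<longleftrightarrow> even (length v)"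
  by (induction rule: braid_equiv.induct) auto

lemma F2_even_length:
  assumes "braid_of_word w \<in> carrier F2"
  shows "even (length w)"
proof -
  have "x \<in> generate B3 {\<sigma>\<^sub>1 [^]\<^bsub>B3\<^esub> (2::nat), \<sigma>\<^sub>2 [^]\<^bsub>B3\<^esub> (2::nat)}
    \<Longrightarrow> \<exists>w. x = braid_of_word w \<and> even (length w)" for x
  proof (induction rule: generate.induct)
    case one
    show ?case by (auto simp: one_B3 intro!: exI[of _ "[]"])
  next
    case (incl h)
    then have "h = braid_of_word [(Sigma1, True), (Sigma1, True)]
      \<or> h = braid_of_word [(Sigma2, True), (Sigma2, True)]"
      by (auto simp: numeral_2_eq_2 \<sigma>\<^sub>1_def \<sigma>\<^sub>2_def mult_B3)
    then show ?case
      by (elim disjE) (intro exI conjI, assumption, simp)+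
  next
    case (inv h)
    then have "inv\<^bsub>B3\<^esub> h = braid_of_word [(Sigma1, False), (Sigma1, False)]
      \<or> inv\<^bsub>B3\<^esub> h = braid_of_word [(Sigma2, False), (Sigma2, False)]"
      by (auto simp: numeral_2_eq_2 \<sigma>\<^sub>1_def \<sigma>\<^sub>2_def mult_B3 inv_B3 inv_word_def)
    then show ?case
      by (elim disjE) (intro exI conjI, assumption, simp)+
  next
    case (eng h1 h2)
    then show ?case by (metis even_add length_append mult_B3)
  qed
  then show ?thesis using assms braid_equiv_length
    by (simp add: F2_def carrier_subgroup_generated) (metis braid3.abs_eq_iff)
qed

lemma sigma2_pow_F2_even:
  assumes "\<sigma>\<^sub>2 [^]\<^bsub>B3\<^esub> (j::int) \<in> carrier F2"
  shows "even j"
proof -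
  have nat: "\<exists>w. \<sigma>\<^sub>2 [^]\<^bsub>B3\<^esub> n = braid_of_word w \<and> length w = n" for n :: nat
  proof (induction n)
    case 0
    show ?case by (simp add: one_B3)
  next
    case (Suc n)
    then show ?case by (metis B3.nat_pow_Suc \<sigma>\<^sub>2_def length_append_singleton mult_B3)
  qed
  show ?thesis
  proof (cases j rule: int_cases2)
    case (nonneg n)
    then show ?thesis using nat[of n] assms F2_even_length by (auto simp: int_pow_int)
  next
    case (nonpos n)
    obtain w where "\<sigma>\<^sub>2 [^]\<^bsub>B3\<^esub> n = braid_of_word w" "length w = n" using nat by blast
    then have "\<sigma>\<^sub>2 [^]\<^bsub>B3\<^esub> j = braid_of_word (inv_word w)" "length (inv_word w) = n"
      by (simp_all add: nonpos B3.int_pow_neg int_pow_int inv_B3 inv_word_def)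
    then show ?thesis using assms F2_even_length nonpos by fastforce
  qed
qed

section \<open>Convex subgroups\<close>

text \<open>
  The braid relation says that conjugation by \<open>\<sigma>\<^sub>1 \<sigma>\<^sub>2\<close> takes \<open>\<sigma>\<^sub>1\<close> to \<open>\<sigma>\<^sub>2\<close>; the rule is this
  fact for powers, rearranged.
\<close>

lemma sigma1_conj_sigma2_pow:
  "inv\<^bsub>B3\<^esub> \<sigma>\<^sub>1 \<otimes>\<^bsub>B3\<^esub> (\<sigma>\<^sub>2 [^]\<^bsub>B3\<^esub> n \<otimes>\<^bsub>B3\<^esub> \<sigma>\<^sub>1)
    = \<sigma>\<^sub>2 \<otimes>\<^bsub>B3\<^esub> (\<sigma>\<^sub>1 [^]\<^bsub>B3\<^esub> (n::nat) \<otimes>\<^bsub>B3\<^esub> inv\<^bsub>B3\<^esub> \<sigma>\<^sub>2)"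
proof -
  have "\<sigma>\<^sub>2 [^]\<^bsub>B3\<^esub> n \<otimes>\<^bsub>B3\<^esub> (\<sigma>\<^sub>1 \<otimes>\<^bsub>B3\<^esub> \<sigma>\<^sub>2) = \<sigma>\<^sub>1 \<otimes>\<^bsub>B3\<^esub> \<sigma>\<^sub>2 \<otimes>\<^bsub>B3\<^esub> \<sigma>\<^sub>1 [^]\<^bsub>B3\<^esub> n"
  proof (induction n)
    case (Suc n)
    have "\<sigma>\<^sub>2 [^]\<^bsub>B3\<^esub> Suc n \<otimes>\<^bsub>B3\<^esub> (\<sigma>\<^sub>1 \<otimes>\<^bsub>B3\<^esub> \<sigma>\<^sub>2) 
      = \<sigma>\<^sub>2 [^]\<^bsub>B3\<^esub> n \<otimes>\<^bsub>B3\<^esub> (\<sigma>\<^sub>2 \<otimes>\<^bsub>B3\<^esub> \<sigma>\<^sub>1 \<otimes>\<^bsub>B3\<^esub> \<sigma>\<^sub>2)"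
      by (simp add: B3.m_assoc)
    also have "\<dots> = \<sigma>\<^sub>2 [^]\<^bsub>B3\<^esub> n \<otimes>\<^bsub>B3\<^esub> (\<sigma>\<^sub>1 \<otimes>\<^bsub>B3\<^esub> \<sigma>\<^sub>2) \<otimes>\<^bsub>B3\<^esub> \<sigma>\<^sub>1"
      by (simp add: B3.m_assoc flip: braid_relation)
    also have "\<dots> = \<sigma>\<^sub>1 \<otimes>\<^bsub>B3\<^esub> \<sigma>\<^sub>2 \<otimes>\<^bsub>B3\<^esub> \<sigma>\<^sub>1 [^]\<^bsub>B3\<^esub> Suc n"
      by (simp only: Suc.IH) (simp add: B3.m_assoc)
    finally show ?case .
  qed auto
  then have "\<sigma>\<^sub>2 [^]\<^bsub>B3\<^esub> n \<otimes>\<^bsub>B3\<^esub> \<sigma>\<^sub>1 = \<sigma>\<^sub>1 \<otimes>\<^bsub>B3\<^esub> \<sigma>\<^sub>2 \<otimes>\<^bsub>B3\<^esub> \<sigma>\<^sub>1 [^]\<^bsub>B3\<^esub> n \<otimes>\<^bsub>B3\<^esub> inv\<^bsub>B3\<^esub> \<sigma>\<^sub>2"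
    by (subst B3.inv_solve_right) (auto simp: B3.m_assoc)
  then show ?thesis by (simp add: B3.m_assoc flip: B3.m_assoc[of "inv\<^bsub>B3\<^esub> \<sigma>\<^sub>1" \<sigma>\<^sub>1])
qed

text \<open>
  Conjugating \<open>\<sigma>\<^sub>2\<^sup>n\<close> uses up one \<open>\<sigma>\<^sub>1\<^sup>-\<^sup>1\<close> and produces \<open>\<sigma>\<^sub>2 \<sigma>\<^sub>1\<^sup>n\<close>. As \<open>n > 0\<close>, this starts with
  \<open>\<sigma>\<^sub>2 \<sigma>\<^sub>1\<close>, so the other \<open>\<sigma>\<^sub>1\<^sup>-\<^sup>1\<close> is absorbed by the case \<open>n = 1\<close> of the same rule, which leaves
  \<open>\<sigma>\<^sub>2 \<sigma>\<^sub>1 \<sigma>\<^sub>2\<^sup>-\<^sup>1\<close> and with it a positive \<open>\<sigma>\<^sub>1\<close>.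
\<close>

lemma sigma1_square_below:
  assumes "n > 0" "y \<in> N1"
  shows "inv\<^bsub>B3\<^esub> (\<sigma>\<^sub>1 [^]\<^bsub>B3\<^esub> (2::nat)) \<otimes>\<^bsub>B3\<^esub> (\<sigma>\<^sub>2 [^]\<^bsub>B3\<^esub> (n::nat) \<otimes>\<^bsub>B3\<^esub> (\<sigma>\<^sub>1 \<otimes>\<^bsub>B3\<^esub> y)) \<in> P1"
proof -
  let ?a = "\<sigma>\<^sub>1" and ?b = "\<sigma>\<^sub>2" and ?A = "inv\<^bsub>B3\<^esub> \<sigma>\<^sub>1" and ?B = "inv\<^bsub>B3\<^esub> \<sigma>\<^sub>2"
  obtain m where n: "n = Suc m" using assms(1) gr0_conv_Suc by blast
  have "inv\<^bsub>B3\<^esub> (?a [^]\<^bsub>B3\<^esub> (2::nat)) \<otimes>\<^bsub>B3\<^esub> (?b [^]\<^bsub>B3\<^esub> n \<otimes>\<^bsub>B3\<^esub> (?a \<otimes>\<^bsub>B3\<^esub> y))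
      = ?A \<otimes>\<^bsub>B3\<^esub> (?A \<otimes>\<^bsub>B3\<^esub> (?b [^]\<^bsub>B3\<^esub> n \<otimes>\<^bsub>B3\<^esub> ?a)) \<otimes>\<^bsub>B3\<^esub> y"
    by (simp add: numeral_2_eq_2 B3.inv_mult_group B3.m_assoc)
  also have "\<dots> = ?A \<otimes>\<^bsub>B3\<^esub> (?b [^]\<^bsub>B3\<^esub> (1::nat) \<otimes>\<^bsub>B3\<^esub> ?a) \<otimes>\<^bsub>B3\<^esub> (?a [^]\<^bsub>B3\<^esub> m \<otimes>\<^bsub>B3\<^esub> ?B \<otimes>\<^bsub>B3\<^esub> y)"
    unfolding n sigma1_conj_sigma2_pow[of "Suc m"] B3_pow_Suc2[of ?a]
    by (simp add: B3.m_assoc)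
  also have "\<dots> = ?b \<otimes>\<^bsub>B3\<^esub> (?a \<otimes>\<^bsub>B3\<^esub> (?B \<otimes>\<^bsub>B3\<^esub> (?a [^]\<^bsub>B3\<^esub> m \<otimes>\<^bsub>B3\<^esub> ?B \<otimes>\<^bsub>B3\<^esub> y)))"
    unfolding sigma1_conj_sigma2_pow by (simp add: B3.m_assoc)
  also have "\<dots> \<in> P1"
    using generators_in_cone P1_subset_N1 assms(2)
    by (intro N1_P1_mult[OF _ P1_N1_mult] N1_mult N1_pow) auto
  finally show ?thesis .
qed

lemma carrier_F2: "carrier F2 = generate B3 {\<sigma>\<^sub>1 [^]\<^bsub>B3\<^esub> (2::nat), \<sigma>\<^sub>2 [^]\<^bsub>B3\<^esub> (2::nat)}"
  by (simp add: F2_def carrier_subgroup_generated)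

lemma subgroup_carrier_F2: "subgroup (carrier F2) B3"
  unfolding carrier_F2 by (rule B3.generate_is_subgroup) simp

lemma less_C_iff:
  assumes "f \<in> carrier F2" "g \<in> carrier F2"
  shows "less_C f g \<longleftrightarrow> inv\<^bsub>B3\<^esub> f \<otimes>\<^bsub>B3\<^esub> g \<in> P_DD"
proof -
  have "inv\<^bsub>F2\<^esub> f = inv\<^bsub>B3\<^esub> f"
    using assms(1) unfolding F2_def by (rule B3.inv_subgroup_generated)
  moreover have "inv\<^bsub>B3\<^esub> f \<otimes>\<^bsub>B3\<^esub> g \<in> carrier F2"
    using assms subgroup_carrier_F2 by (simp add: subgroup.m_closed subgroup.m_inv_closed)
  ultimately show ?thesis
    by (simp add: less_C_def cone_less_def P_C_def F2_def)
qed

theorem theoremA5: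
  fixes S :: "braid3 set"
  assumes "subgroup S F2"
    and "order_convex (carrier F2) less_C S"
    and "generate B3 {\<sigma>\<^sub>2 [^]\<^bsub>B3\<^esub> (-2::int)} \<subset> S"
  shows "S = carrier F2"
proof -
  let ?a2 = "\<sigma>\<^sub>1 [^]\<^bsub>B3\<^esub> (2::nat)"
  have SF: "S \<subseteq> carrier F2" by (rule subgroup.subset[OF assms(1)])
  have S: "subgroup S B3"
    using assms(1) by (simp add: F2_def B3.subgroup_subgroup_generated_iff)
  have b: "\<sigma>\<^sub>2 [^]\<^bsub>B3\<^esub> (2 * k :: int) \<in> generate B3 {\<sigma>\<^sub>2 [^]\<^bsub>B3\<^esub> (-2::int)}" for k
  proof -
    have "\<sigma>\<^sub>2 [^]\<^bsub>B3\<^esub> (2 * k) = (\<sigma>\<^sub>2 [^]\<^bsub>B3\<^esub> (-2::int)) [^]\<^bsub>B3\<^esub> (- k)"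
      by (simp add: B3.int_pow_pow)
    then show ?thesis by (auto simp: B3.generate_pow)
  qed
  obtain s where s: "s \<in> S" "s \<notin> generate B3 {\<sigma>\<^sub>2 [^]\<^bsub>B3\<^esub> (-2::int)}"
    using assms(3) by blast
  have "\<not> (\<exists>j::int. s = \<sigma>\<^sub>2 [^]\<^bsub>B3\<^esub> j)"
    using s SF b sigma2_pow_F2_even by (metis evenE subsetD)
  then have "s \<in> P1 \<or> inv\<^bsub>B3\<^esub> s \<in> P1" using sigma1_trichotomy by blast
  then obtain t where t: "t \<in> S" "t \<in> P1"
    using s(1) subgroup.m_inv_closed[OF S] by blast
  obtain j :: int and y where y: "t = \<sigma>\<^sub>2 [^]\<^bsub>B3\<^esub> j \<otimes>\<^bsub>B3\<^esub> (\<sigma>\<^sub>1 \<otimes>\<^bsub>B3\<^esub> y)" "y \<in> N1"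
    using P1_first_sigma1[OF t(2)] by metis
  \<comment> \<open>Any \<open>k\<close> with \<open>2 * k + j > 0\<close> serves.\<close>
  define k where "k = \<bar>j\<bar> + 1"
  define n where "n = nat (2 * k + j)"
  have n: "2 * k + j = int n" "n > 0" by (auto simp: n_def k_def)
  define f where "f = \<sigma>\<^sub>2 [^]\<^bsub>B3\<^esub> (2 * k) \<otimes>\<^bsub>B3\<^esub> t"
  have "f = \<sigma>\<^sub>2 [^]\<^bsub>B3\<^esub> n \<otimes>\<^bsub>B3\<^esub> (\<sigma>\<^sub>1 \<otimes>\<^bsub>B3\<^esub> y)"
    by (simp add: f_def y(1) B3.int_pow_mult flip: B3.m_assoc int_pow_int n(1))
  then have "inv\<^bsub>B3\<^esub> ?a2 \<otimes>\<^bsub>B3\<^esub> f \<in> P_DD"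
    using sigma1_square_below[OF n(2) y(2)] by (simp add: P_DD_def)
  moreover have fS: "f \<in> S"
    using b assms(3) t(1) subgroup.m_closed[OF S] unfolding f_def by blast
  moreover have a2: "?a2 \<in> carrier F2" unfolding carrier_F2 by (rule generate.incl) simp
  ultimately have "less_C ?a2 f" using SF by (simp add: less_C_iff subsetD)
  moreover have "less_C \<one>\<^bsub>B3\<^esub> ?a2"
  proof -
    have "?a2 \<in> P1"
      using generators_in_cone(1) P1_N1_mult P1_subset_N1 by (auto simp: numeral_2_eq_2)
    then show ?thesis
      using a2 subgroup.one_closed[OF subgroup_carrier_F2] by (simp add: less_C_iff P_DD_def)
  qed
  ultimately have "?a2 \<in> S"
    using assms(2) fS a2 subgroup.one_closed[OF S] unfolding order_convex_def by blast
  moreover have "\<sigma>\<^sub>2 [^]\<^bsub>B3\<^esub> (2::nat) \<in> S"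
    using b[of 1] assms(3) by (auto simp: int_pow_int[symmetric])
  ultimately have "carrier F2 \<subseteq> S"
    unfolding carrier_F2 by (intro B3.generate_subgroup_incl S) auto
  with SF show ?thesis by blast
qed

end
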